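(* Let $r\ge0$. There exist constants $0<c_r\le C_r$ and $N_r$ such that the following holds. Let $n\ge N_r$, and let $K,f$ be integers with $0\le K\le r\le f/2$ and $f\le n$. For all $\lambda\vdash n$ with $n-\lambda_1=r$ and all $\mu\vdash f$ with $\mu\subset\lambda$ and $f-\mu_1=r-K$, $$c_r\left(\frac fn\right)^r f^{-K}\le\frac{d_\mu}{d_\lambda}\le C_r\left(\frac fn\right)^r f^{-K}.$$ Moreover, if $K=0$ (i.e. $\mu^*=\lambda^*$), then, with $k=n-f$ and $T(r)=r(r+1)/2$, $$\frac{d_\mu}{d_\lambda}=\left(\frac fn\right)^r\left(1-T(r)\frac{k}{fn}+E\right),\qquad |E|\le \frac{C_r}{f^2}.$$
   Context: For a partition $\lambda$, $d_\lambda$ denotes the number of standard Young tableaux of shape $\lambda$ (the dimension of the corresponding irreducible representation of the symmetric group). $\lambda_1$ is the first row length, $\lambda^*=(\lambda_2,\lambda_3,\dots)$ is $\lambda$ with the first row removed, and $\mu\subset\lambda$ means containment of Young diagrams. *)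

theory Defs
  imports Complex_Main
begin

definition is_partition :: "nat \<Rightarrow> nat list \<Rightarrow> bool" where
  "is_partition n lam \<longleftrightarrow> sorted_wrt (\<ge>) lam \<and> (\<forall>x\<in>set lam. 0 < x) \<and> sum_list lam = n"

definition young_cells :: "nat list \<Rightarrow> (nat \<times> nat) set" where
  "young_cells lam = {(i, j). i < length lam \<and> j < lam ! i}"

definition SYT :: "nat list \<Rightarrow> ((nat \<times> nat) \<Rightarrow> nat) set" where
  "SYT lam = {T. bij_betw T (young_cells lam) {1..sum_list lam}
      \<and> (\<forall>c. c \<notin> young_cells lam \<longrightarrow> T c = 0)
      \<and> (\<forall>i j. (i, Suc j) \<in> young_cells lam \<longrightarrow> T (i, j) < T (i, Suc j))
      \<and> (\<forall>i j. (Suc i, j) \<in> young_cells lam \<longrightarrow> T (i, j) < T (Suc i, j))}"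

definition dim_irrep :: "nat list \<Rightarrow> nat" where
  "dim_irrep lam = card (SYT lam)"

definition first_row :: "nat list \<Rightarrow> nat" where
  "first_row lam = (case lam of [] \<Rightarrow> 0 | x # _ \<Rightarrow> x)"

definition contained :: "nat list \<Rightarrow> nat list \<Rightarrow> bool" where
  "contained mu lam \<longleftrightarrow> young_cells mu \<subseteq> young_cells lam"

end

(*
  A standard tableau of shape (m, xs) with n cells is determined by the set S of its entries
  below the first row, an s-subset of {2..n} with s = n - m, together with the standardization
  of those entries, a standard tableau of shape xs.  Hence d(m, xs) <= d(xs) * C(n - 1, s).
  Conversely every such pair arises, provided the complement of S, written increasingly into
  the first row, stays above the second row.  This is the case whenever S meets {2..2s} in at
  most one point, and the remaining "crowded" sets number only O(n^(s - 2)).  Together with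
  C(n - 1, s) = n^s / s! * (1 - T(s)/n + O(1/n^2)) this yields the expansion

    d(m, xs) = d(xs) * n^s / s! * (1 - T(s)/n + O(1/n^2)).

  Both claims follow: d(mu) and d(lambda) are comparable to f^(r - K) and n^r, and if the
  tails agree the factor d(xs) / r! cancels in the ratio, which becomes
  (f/n)^r * (1 - T(r)/f + O(1/f^2)) / (1 - T(r)/n + O(1/n^2)).
*)

theory Submission
  imports Defs "HOL-Library.FuncSet"
begin

section \<open>Ranks in finite sets of natural numbers\<close>

definition set_rank :: "nat set \<Rightarrow> nat \<Rightarrow> nat" where
  "set_rank A x = card {y\<in>A. y \<le> x}"

definition set_select :: "nat set \<Rightarrow> nat \<Rightarrow> nat" where
  "set_select A k = the_inv_into A (set_rank A) k"

lemma set_rank_mono: "finite A \<Longrightarrow> x \<le> y \<Longrightarrow> set_rank A x \<le> set_rank A y"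
  unfolding set_rank_def by (rule card_mono) auto

lemma set_rank_strict_mono:
  assumes "finite A" "y \<in> A" "x < y"
  shows "set_rank A x < set_rank A y"
proof -
  have "y \<in> {z\<in>A. z \<le> y} - {z\<in>A. z \<le> x}" "{z\<in>A. z \<le> x} \<subseteq> {z\<in>A. z \<le> y}"
    using assms by auto
  then have "{z\<in>A. z \<le> x} \<subset> {z\<in>A. z \<le> y}" by blast
  then show ?thesis unfolding set_rank_def by (rule psubset_card_mono[rotated]) (use assms in auto)
qed

lemma set_rank_le_card: "finite A \<Longrightarrow> set_rank A x \<le> card A"
  unfolding set_rank_def by (rule card_mono) auto

lemma set_rank_bij_betw:
  assumes "finite A"
  shows "bij_betw (set_rank A) A {1..card A}"
proof -
  have inj: "inj_on (set_rank A) A"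
    by (rule inj_onI) (metis assms set_rank_strict_mono less_irrefl nat_neq_iff)
  have "1 \<le> set_rank A x" if "x \<in> A" for x
    unfolding set_rank_def using assms that
    by (metis (mono_tags, lifting) One_nat_def Suc_leI card_gt_0_iff empty_iff finite_subset
        mem_Collect_eq order_refl subsetI)
  then have "set_rank A ` A \<subseteq> {1..card A}"
    using set_rank_le_card[OF assms] by auto
  moreover have "card (set_rank A ` A) = card {1..card A}"
    using card_image[OF inj] by simp
  ultimately have "set_rank A ` A = {1..card A}"
    by (intro card_subset_eq) auto
  then show ?thesis using inj by (simp add: bij_betw_def)
qed

lemma set_select_in:
  assumes "finite A" "k \<in> {1..card A}"
  shows "set_select A k \<in> A"
  unfolding set_select_def using set_rank_bij_betw[OF assms(1)] assms(2)
  by (metis bij_betw_def the_inv_into_into order_refl)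

lemma set_rank_select:
  assumes "finite A" "k \<in> {1..card A}"
  shows "set_rank A (set_select A k) = k"
  unfolding set_select_def using set_rank_bij_betw[OF assms(1)] assms(2)
  by (metis bij_betw_def f_the_inv_into_f)

lemma set_select_rank:
  assumes "finite A" "x \<in> A"
  shows "set_select A (set_rank A x) = x"
  unfolding set_select_def using set_rank_bij_betw[OF assms(1)] assms(2)
  by (simp add: bij_betw_def the_inv_into_f_f)

lemma set_select_strict_mono:
  assumes "finite A" "k \<in> {1..card A}" "l \<in> {1..card A}" "k < l"
  shows "set_select A k < set_select A l"
proof (rule ccontr)
  assume "\<not> set_select A k < set_select A l"
  then have "set_rank A (set_select A l) \<le> set_rank A (set_select A k)"
    by (intro set_rank_mono[OF assms(1)]) simp
  then show False using set_rank_select[OF assms(1)] assms(2-4) by simp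
qed

lemma set_select_image:
  assumes "finite A"
  shows "set_select A ` {1..card A} = A"
proof
  show "set_select A ` {1..card A} \<subseteq> A" using set_select_in[OF assms] by auto
  show "A \<subseteq> set_select A ` {1..card A}"
  proof
    fix x assume "x \<in> A"
    then have "x = set_select A (set_rank A x)" "set_rank A x \<in> {1..card A}"
      using set_select_rank[OF assms] set_rank_bij_betw[OF assms] by (auto dest: bij_betwE)
    then show "x \<in> set_select A ` {1..card A}" by blast
  qed
qed

lemma set_select_less:
  assumes "finite A" "k \<in> {1..card A}" "k \<le> card {y\<in>A. y < x}"
  shows "set_select A k < x"
proof (rule ccontr)
  let ?e = "set_select A k"
  assume "\<not> ?e < x"
  then have "{y\<in>A. y < x} \<subseteq> {y\<in>A. y \<le> ?e} - {?e}" by auto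
  then have "card {y\<in>A. y < x} \<le> card ({y\<in>A. y \<le> ?e} - {?e})"
    by (intro card_mono) (use assms(1) in auto)
  also have "\<dots> = k - 1"
    using set_select_in[OF assms(1,2)] set_rank_select[OF assms(1,2)] assms(1)
    unfolding set_rank_def by (subst card_Diff_singleton) auto
  finally show False using assms(2,3) by auto
qed

lemma strict_mono_on_lessThan_SucI:
  fixes g :: "nat \<Rightarrow> 'a::order"
  assumes "\<And>k. Suc k < m \<Longrightarrow> g k < g (Suc k)"
  shows "strict_mono_on {..<m} g"
proof (rule strict_mono_onI)
  fix j j' :: nat assume "j \<in> {..<m}" "j' \<in> {..<m}" "j < j'"
  then show "g j < g j'"
  proof (induction j')
    case (Suc j')
    then show ?case
      using assms[of j'] by (cases "j = j'") (auto intro: order.strict_trans)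
  qed simp
qed

lemma set_rank_strict_mono_image:
  assumes "strict_mono_on {..<m} g" "j < m"
  shows "set_rank (g ` {..<m}) (g j) = Suc j"
proof -
  have "{y \<in> g ` {..<m}. y \<le> g j} = g ` {..j}"
    using assms strict_mono_on_less_eq[OF assms(1)] by fastforce
  moreover have "inj_on g {..j}"
    by (rule inj_on_subset[OF strict_mono_on_imp_inj_on[OF assms(1)]]) (use assms(2) in auto)
  ultimately show ?thesis unfolding set_rank_def by (simp add: card_image)
qed

section \<open>Young diagrams and standard tableaux\<close>

lemma young_cells_Nil [simp]: "young_cells [] = {}"
  unfolding young_cells_def by auto

lemma young_cells_Cons:
  "young_cells (a # xs) = (\<lambda>j. (0, j)) ` {..<a} \<union> (\<lambda>(i, j). (Suc i, j)) ` young_cells xs"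
  unfolding young_cells_def by (auto simp: image_iff nth_Cons split: nat.splits)

lemma Suc_mem_young_cells_Cons [simp]:
  "(Suc i, j) \<in> young_cells (a # xs) \<longleftrightarrow> (i, j) \<in> young_cells xs"
  unfolding young_cells_def by auto

lemma zero_mem_young_cells_Cons [simp]: "(0, j) \<in> young_cells (a # xs) \<longleftrightarrow> j < a"
  unfolding young_cells_def by auto

lemma young_cells_left: "(i, Suc j) \<in> young_cells xs \<Longrightarrow> (i, j) \<in> young_cells xs"
  unfolding young_cells_def by auto

lemma young_cells_up:
  assumes "sorted_wrt (\<ge>) xs" "(Suc i, j) \<in> young_cells xs"
  shows "(i, j) \<in> young_cells xs"
proof -
  have "Suc i < length xs" "j < xs ! Suc i" using assms(2) unfolding young_cells_def by auto
  moreover have "xs ! Suc i \<le> xs ! i"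
    using assms(1) \<open>Suc i < length xs\<close> by (simp add: sorted_wrt_iff_nth_less)
  ultimately show ?thesis unfolding young_cells_def by auto
qed

lemma young_cells_head_less:
  assumes "sorted_wrt (\<ge>) (m # xs)" "(0, j) \<in> young_cells xs"
  shows "j < m"
proof -
  have "0 < length xs" "j < xs ! 0" using assms(2) unfolding young_cells_def by auto
  moreover have "xs ! 0 \<le> m" using assms(1) \<open>0 < length xs\<close> by (cases xs) auto
  ultimately show ?thesis by simp
qed

lemma finite_young_cells [simp]: "finite (young_cells xs)"
  by (induction xs) (simp_all add: young_cells_Cons)

lemma card_young_cells: "card (young_cells xs) = sum_list xs"
proof (induction xs)
  case (Cons a xs)
  have "(\<lambda>j. (0::nat, j)) ` {..<a} \<inter> (\<lambda>(i, j). (Suc i, j)) ` young_cells xs = {}" by auto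
  moreover have "inj_on (\<lambda>j. (0::nat, j)) {..<a}" "inj_on (\<lambda>(i, j). (Suc i, j)) (young_cells xs)"
    by (auto simp: inj_on_def)
  ultimately show ?case
    unfolding young_cells_Cons using Cons by (simp add: card_Un_disjoint card_image)
qed simp

lemma young_cells_inject:
  assumes "\<forall>x\<in>set xs. 0 < x" "\<forall>x\<in>set ys. 0 < x" "young_cells xs = young_cells ys"
  shows "xs = ys"
proof -
  have first_col: "(i, 0) \<in> young_cells zs \<longleftrightarrow> i < length zs" if "\<forall>x\<in>set zs. 0 < x" for zs i
    using that unfolding young_cells_def by auto
  have len: "length xs = length ys"
  proof (rule ccontr)
    assume "length xs \<noteq> length ys"
    then consider "length xs < length ys" | "length ys < length xs" by linarith
    then show False
      using assms(3) first_col[OF assms(1)] first_col[OF assms(2)] by cases blast+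
  qed
  show ?thesis
  proof (rule nth_equalityI[OF len])
    fix i assume i: "i < length xs"
    have "j < xs ! i \<longleftrightarrow> j < ys ! i" for j
    proof -
      have "j < xs ! i \<longleftrightarrow> (i, j) \<in> young_cells xs" using i unfolding young_cells_def by auto
      also have "\<dots> \<longleftrightarrow> j < ys ! i" using i len assms(3) unfolding young_cells_def by auto
      finally show ?thesis .
    qed
    then show "xs ! i = ys ! i" by (metis less_irrefl nat_neq_iff)
  qed
qed

lemma SYT_bij_betw: "T \<in> SYT lam \<Longrightarrow> bij_betw T (young_cells lam) {1..sum_list lam}"
  unfolding SYT_def by auto

lemma SYT_outside: "T \<in> SYT lam \<Longrightarrow> c \<notin> young_cells lam \<Longrightarrow> T c = 0"
  unfolding SYT_def by (cases c) auto

lemma SYT_row_less: "T \<in> SYT lam \<Longrightarrow> (i, Suc j) \<in> young_cells lam \<Longrightarrow> T (i, j) < T (i, Suc j)"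
  unfolding SYT_def by auto

lemma SYT_col_less: "T \<in> SYT lam \<Longrightarrow> (Suc i, j) \<in> young_cells lam \<Longrightarrow> T (i, j) < T (Suc i, j)"
  unfolding SYT_def by auto

lemma SYT_range: "T \<in> SYT lam \<Longrightarrow> c \<in> young_cells lam \<Longrightarrow> T c \<in> {1..sum_list lam}"
  using SYT_bij_betw bij_betwE by blast

lemma SYT_inj_on: "T \<in> SYT lam \<Longrightarrow> inj_on T (young_cells lam)"
  using SYT_bij_betw bij_betw_imp_inj_on by blast

lemma SYT_image: "T \<in> SYT lam \<Longrightarrow> T ` young_cells lam = {1..sum_list lam}"
  using SYT_bij_betw bij_betw_imp_surj_on by blast

lemma SYT_Nil: "SYT [] = {\<lambda>_. 0}"
  unfolding SYT_def by (auto simp: bij_betw_def)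

lemma SYT_first_row_ge:
  assumes "P \<in> SYT xs" "(0, j) \<in> young_cells xs"
  shows "Suc j \<le> P (0, j)"
  using assms(2)
proof (induction j)
  case 0 then show ?case using SYT_range[OF assms(1)] by force
next
  case (Suc j)
  from Suc.prems have "(0, j) \<in> young_cells xs" by (rule young_cells_left)
  then show ?case using Suc SYT_row_less[OF assms(1), of 0 j] by simp
qed

lemma finite_SYT: "finite (SYT lam)"
  and card_SYT_le: "card (SYT lam) \<le> sum_list lam ^ sum_list lam"
proof -
  let ?C = "young_cells lam" and ?n = "sum_list lam"
  have inj: "inj_on (\<lambda>T. restrict T ?C) (SYT lam)"
  proof (rule inj_onI, rule ext)
    fix T T' c assume TT': "T \<in> SYT lam" "T' \<in> SYT lam" "restrict T ?C = restrict T' ?C"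
    show "T c = T' c"
    proof (cases "c \<in> ?C")
      case True then show ?thesis using fun_cong[OF TT'(3), of c] by simp
    next
      case False then show ?thesis using SYT_outside[OF TT'(1)] SYT_outside[OF TT'(2)] by simp
    qed
  qed
  have sub: "(\<lambda>T. restrict T ?C) ` SYT lam \<subseteq> PiE ?C (\<lambda>_. {1..?n})"
    using SYT_range by fastforce
  have fin: "finite (PiE ?C (\<lambda>_. {1..?n}))" by (intro finite_PiE) auto
  show "finite (SYT lam)"
    using finite_subset[OF sub fin] finite_imageD inj by blast
  have "card (SYT lam) \<le> card (PiE ?C (\<lambda>_. {1..?n}))"
    using card_inj_on_le[OF inj sub fin] .
  also have "\<dots> = ?n ^ ?n" by (simp add: card_PiE card_young_cells)
  finally show "card (SYT lam) \<le> ?n ^ ?n" .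
qed

section \<open>Removing the first row of a tableau\<close>

definition lower_entries :: "nat list \<Rightarrow> (nat \<times> nat \<Rightarrow> nat) \<Rightarrow> nat set" where
  "lower_entries xs T = (\<lambda>(i, j). T (Suc i, j)) ` young_cells xs"

definition lower_tableau :: "nat list \<Rightarrow> (nat \<times> nat \<Rightarrow> nat) \<Rightarrow> nat \<times> nat \<Rightarrow> nat" where
  "lower_tableau xs T = (\<lambda>c. if c \<in> young_cells xs
     then set_rank (lower_entries xs T) (T (Suc (fst c), snd c)) else 0)"

definition attach_row :: "nat \<Rightarrow> nat list \<Rightarrow> (nat \<times> nat \<Rightarrow> nat) \<Rightarrow> nat set \<Rightarrow> nat \<times> nat \<Rightarrow> nat" where
  "attach_row m xs P S = (\<lambda>(i, j).
     if i = 0 then (if j < m then set_select ({1..m + sum_list xs} - S) (Suc j) else 0)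
     else if (i - 1, j) \<in> young_cells xs then set_select S (P (i - 1, j)) else 0)"

lemma bij_betw_lower_entries:
  assumes T: "T \<in> SYT (m # xs)"
  shows "bij_betw (\<lambda>(i, j). T (Suc i, j)) (young_cells xs) (lower_entries xs T)"
proof -
  have "inj_on (\<lambda>(i, j). T (Suc i, j)) (young_cells xs)"
  proof (rule inj_onI, clarify)
    fix a b c d assume "(a, b) \<in> young_cells xs" "(c, d) \<in> young_cells xs" "T (Suc a, b) = T (Suc c, d)"
    then show "a = c \<and> b = d" using SYT_inj_on[OF T] by (auto dest: inj_onD)
  qed
  then show ?thesis unfolding lower_entries_def by (simp add: bij_betw_def)
qed

lemma card_lower_entries: "T \<in> SYT (m # xs) \<Longrightarrow> card (lower_entries xs T) = sum_list xs"
  using bij_betw_same_card[OF bij_betw_lower_entries] card_young_cells by metis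

lemma lower_entries_subset:
  assumes srt: "sorted_wrt (\<ge>) (m # xs)" and T: "T \<in> SYT (m # xs)"
  shows "lower_entries xs T \<subseteq> {2..m + sum_list xs}"
proof
  fix x assume "x \<in> lower_entries xs T"
  then obtain i j where ij: "(i, j) \<in> young_cells xs" "x = T (Suc i, j)"
    unfolding lower_entries_def by auto
  have "(i, j) \<in> young_cells (m # xs)"
    using srt ij young_cells_head_less[OF srt] young_cells_up[of xs] by (cases i) auto
  then have "1 \<le> T (i, j)" using SYT_range[OF T] by auto
  moreover have "T (i, j) < x" using SYT_col_less[OF T, of i j] ij by simp
  moreover have "x \<le> m + sum_list xs" using SYT_range[OF T, of "(Suc i, j)"] ij by simp
  ultimately show "x \<in> {2..m + sum_list xs}" by auto
qed

lemma lower_tableau_SYT: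
  assumes srt: "sorted_wrt (\<ge>) (m # xs)" and T: "T \<in> SYT (m # xs)"
  shows "lower_tableau xs T \<in> SYT xs"
  unfolding SYT_def
proof (intro CollectI conjI allI impI)
  let ?Y = "young_cells xs" and ?S = "lower_entries xs T"
  have finS: "finite ?S" unfolding lower_entries_def by simp
  have in_S: "T (Suc i, j) \<in> ?S" if "(i, j) \<in> ?Y" for i j
    using that unfolding lower_entries_def by auto
  have "bij_betw (set_rank ?S \<circ> (\<lambda>(i, j). T (Suc i, j))) ?Y {1..card ?S}"
    by (rule bij_betw_trans[OF bij_betw_lower_entries[OF T] set_rank_bij_betw[OF finS]])
  moreover have "lower_tableau xs T c = (set_rank ?S \<circ> (\<lambda>(i, j). T (Suc i, j))) c" if "c \<in> ?Y" for c
    using that by (auto simp: lower_tableau_def split: prod.splits)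
  ultimately show "bij_betw (lower_tableau xs T) ?Y {1..sum_list xs}"
    using card_lower_entries[OF T] bij_betw_cong by (metis (no_types, lifting))
  show "lower_tableau xs T c = 0" if "c \<notin> ?Y" for c using that by (simp add: lower_tableau_def)
  show "lower_tableau xs T (i, j) < lower_tableau xs T (i, Suc j)" if a: "(i, Suc j) \<in> ?Y" for i j
    using a young_cells_left[OF a] set_rank_strict_mono[OF finS in_S[OF a]]
      SYT_row_less[OF T, of "Suc i" j] by (simp add: lower_tableau_def)
  show "lower_tableau xs T (i, j) < lower_tableau xs T (Suc i, j)" if a: "(Suc i, j) \<in> ?Y" for i j
    using a young_cells_up[OF _ a] srt set_rank_strict_mono[OF finS in_S[OF a]]
      SYT_col_less[OF T, of "Suc i" j] by (simp add: lower_tableau_def)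
qed

lemma first_row_entries:
  assumes T: "T \<in> SYT (m # xs)"
  shows "{1..m + sum_list xs} - lower_entries xs T = (\<lambda>j. T (0, j)) ` {..<m}"
proof -
  let ?row = "(\<lambda>j. (0::nat, j)) ` {..<m}" and ?lower = "(\<lambda>(i, j). (Suc i, j)) ` young_cells xs"
  have U: "T ` ?row \<union> T ` ?lower = {1..m + sum_list xs}"
    using SYT_image[OF T] by (simp add: young_cells_Cons image_Un)
  have disj: "T ` ?row \<inter> T ` ?lower = {}"
  proof (rule ccontr)
    assume "T ` ?row \<inter> T ` ?lower \<noteq> {}"
    then obtain a b c where "a < m" "(b, c) \<in> young_cells xs" "T (0, a) = T (Suc b, c)" by auto
    then show False using inj_onD[OF SYT_inj_on[OF T], of "(0, a)" "(Suc b, c)"] by simp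
  qed
  have "lower_entries xs T = T ` ?lower" unfolding lower_entries_def by (auto simp: image_iff)
  then have "{1..m + sum_list xs} - lower_entries xs T = (T ` ?row \<union> T ` ?lower) - T ` ?lower"
    using U by simp
  also have "\<dots> = T ` ?row" using disj by (simp add: Un_Diff Diff_triv)
  finally show ?thesis by (simp add: image_image)
qed

lemma attach_row_lower_parts:
  assumes T: "T \<in> SYT (m # xs)"
  shows "attach_row m xs (lower_tableau xs T) (lower_entries xs T) = T"
proof
  let ?S = "lower_entries xs T" and ?R = "{1..m + sum_list xs} - lower_entries xs T"
  have "strict_mono_on {..<m} (\<lambda>j. T (0, j))"
    by (rule strict_mono_on_lessThan_SucI) (simp add: SYT_row_less[OF T])
  then have rank_row: "set_rank ?R (T (0, j)) = Suc j" if "j < m" for j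
    unfolding first_row_entries[OF T] using that by (rule set_rank_strict_mono_image)
  have finS: "finite ?S" unfolding lower_entries_def by simp
  fix c :: "nat \<times> nat"
  obtain i j where c: "c = (i, j)" by force
  show "attach_row m xs (lower_tableau xs T) ?S c = T c"
  proof (cases i)
    case 0
    have "T (0, j) \<in> ?R" if "j < m" using first_row_entries[OF T] that by auto
    then show ?thesis
      using c 0 rank_row set_select_rank[of ?R "T (0, j)"] SYT_outside[OF T, of "(0, j)"]
      by (auto simp: attach_row_def)
  next
    case (Suc i')
    have "T (Suc i', j) \<in> ?S" if "(i', j) \<in> young_cells xs"
      using that unfolding lower_entries_def by force
    then show ?thesis
      using c Suc set_select_rank[OF finS] SYT_outside[OF T, of "(Suc i', j)"]
      by (auto simp: attach_row_def lower_tableau_def)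
  qed
qed

lemma lower_parts_attach_row:
  assumes P: "P \<in> SYT xs" and S: "S \<subseteq> {1..m + sum_list xs}" "card S = sum_list xs"
  shows "lower_entries xs (attach_row m xs P S) = S"
    and "lower_tableau xs (attach_row m xs P S) = P"
proof -
  let ?Y = "young_cells xs"
  have finS: "finite S" by (rule finite_subset[OF S(1)]) simp
  have "lower_entries xs (attach_row m xs P S) = set_select S ` (P ` ?Y)"
    unfolding lower_entries_def image_image by (rule image_cong) (auto simp: attach_row_def)
  also have "\<dots> = S" using SYT_image[OF P] S(2) set_select_image[OF finS] by simp
  finally show entries: "lower_entries xs (attach_row m xs P S) = S" .
  show "lower_tableau xs (attach_row m xs P S) = P"
  proof
    fix c show "lower_tableau xs (attach_row m xs P S) c = P c"
    proof (cases "c \<in> ?Y")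
      case True
      then have "P c \<in> {1..card S}" using SYT_range[OF P] S(2) by simp
      then show ?thesis using True entries set_rank_select[OF finS]
        by (cases c) (simp add: lower_tableau_def attach_row_def)
    next
      case False then show ?thesis using SYT_outside[OF P] by (simp add: lower_tableau_def)
    qed
  qed
qed

text \<open>An entry \<open>x\<close> of \<open>S\<close> placed in the second row lies in a column \<open>j < min (set_rank S x) m\<close>,
  below the \<open>(j + 1)\<close>-st element of the complement; the last condition makes it larger.\<close>

definition row_attachable :: "nat \<Rightarrow> nat list \<Rightarrow> nat set \<Rightarrow> bool" where
  "row_attachable m xs S \<longleftrightarrow> S \<subseteq> {1..m + sum_list xs} \<and> card S = sum_list xs \<and>
     (\<forall>x\<in>S. min (set_rank S x) m \<le> card {y \<in> {1..m + sum_list xs} - S. y < x})"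

lemma attach_row_bij_betw:
  assumes P: "P \<in> SYT xs" and S: "S \<subseteq> {1..m + sum_list xs}" "card S = sum_list xs"
  shows "bij_betw (attach_row m xs P S) (young_cells (m # xs)) {1..m + sum_list xs}"
proof -
  let ?Y = "young_cells xs" and ?n = "m + sum_list xs"
  let ?row = "(\<lambda>j. (0::nat, j)) ` {..<m}" and ?sh = "\<lambda>(i::nat, j::nat). (Suc i, j)"
  let ?R = "{1..?n} - S" and ?B = "attach_row m xs P S"
  have finS: "finite S" by (rule finite_subset[OF S(1)]) simp
  have cR: "card ?R = m" using S finS by (subst card_Diff_subset) auto
  have "?B ` ?row = set_select ?R ` {1..card ?R}"
    using cR by (auto simp: attach_row_def image_iff Bex_def) (metis Suc_le_eq Suc_pred)
  then have im_row: "?B ` ?row = ?R" using set_select_image[of ?R] by simp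
  have "?B ` (?sh ` ?Y) = set_select S ` (P ` ?Y)"
    unfolding image_image by (rule image_cong) (auto simp: attach_row_def)
  then have im_lower: "?B ` (?sh ` ?Y) = S"
    using SYT_image[OF P] set_select_image[OF finS] S(2) by simp
  have image: "?B ` young_cells (m # xs) = {1..?n}"
    using im_row im_lower S(1) by (auto simp: young_cells_Cons image_Un)
  moreover have "inj_on ?B (young_cells (m # xs))"
    by (rule eq_card_imp_inj_on) (use image card_young_cells[of "m # xs"] in auto)
  ultimately show ?thesis by (simp add: bij_betw_def)
qed

lemma attach_row_col_less_first_row:
  assumes srt: "sorted_wrt (\<ge>) (m # xs)" and P: "P \<in> SYT xs" and S: "row_attachable m xs S"
    and j: "(0, j) \<in> young_cells xs"
  shows "attach_row m xs P S (0, j) < attach_row m xs P S (Suc 0, j)"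
proof -
  let ?R = "{1..m + sum_list xs} - S" and ?x = "set_select S (P (0, j))"
  have S_sub: "S \<subseteq> {1..m + sum_list xs}" and cS: "card S = sum_list xs"
    using S unfolding row_attachable_def by auto
  have finS: "finite S" by (rule finite_subset[OF S_sub]) simp
  have cR: "card ?R = m" using S_sub cS finS by (subst card_Diff_subset) auto
  have jm: "j < m" using young_cells_head_less[OF srt j] .
  have P_range: "P (0, j) \<in> {1..card S}" using SYT_range[OF P j] cS by simp
  have "Suc j \<le> min (set_rank S ?x) m"
    using set_rank_select[OF finS P_range] SYT_first_row_ge[OF P j] jm by simp
  also have "\<dots> \<le> card {y \<in> ?R. y < ?x}"
    using S set_select_in[OF finS P_range] unfolding row_attachable_def by blast
  finally have "set_select ?R (Suc j) < ?x" using set_select_less[of ?R] cR jm by simp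
  then show ?thesis using j jm by (simp add: attach_row_def)
qed

lemma attach_row_row_less:
  assumes P: "P \<in> SYT xs" and S: "S \<subseteq> {1..m + sum_list xs}" "card S = sum_list xs"
    and ij: "(i, Suc j) \<in> young_cells (m # xs)"
  shows "attach_row m xs P S (i, j) < attach_row m xs P S (i, Suc j)"
proof (cases i)
  case 0
  let ?R = "{1..m + sum_list xs} - S"
  have "card ?R = m" using S finite_subset[OF S(1)] by (subst card_Diff_subset) auto
  then show ?thesis
    using 0 ij set_select_strict_mono[of ?R "Suc j" "Suc (Suc j)"] by (simp add: attach_row_def)
next
  case (Suc i')
  then have ij': "(i', Suc j) \<in> young_cells xs" using ij by simp
  have "finite S" by (rule finite_subset[OF S(1)]) simp
  then show ?thesis
    using Suc ij' young_cells_left[OF ij'] SYT_row_less[OF P ij'] SYT_range[OF P] S(2)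
      set_select_strict_mono[of S] by (simp add: attach_row_def)
qed

lemma attach_row_SYT:
  assumes srt: "sorted_wrt (\<ge>) (m # xs)" and P: "P \<in> SYT xs" and S: "row_attachable m xs S"
  shows "attach_row m xs P S \<in> SYT (m # xs)"
  unfolding SYT_def
proof (intro CollectI conjI allI impI)
  let ?B = "attach_row m xs P S"
  have S_sub: "S \<subseteq> {1..m + sum_list xs}" and cS: "card S = sum_list xs"
    using S unfolding row_attachable_def by auto
  have finS: "finite S" by (rule finite_subset[OF S_sub]) simp
  show "bij_betw ?B (young_cells (m # xs)) {1..sum_list (m # xs)}"
    using attach_row_bij_betw[OF P S_sub cS] by simp
  show "?B c = 0" if "c \<notin> young_cells (m # xs)" for c
  proof -
    obtain i j where "c = (i, j)" by force
    with that show ?thesis by (cases i) (auto simp: attach_row_def)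
  qed
  show "?B (i, j) < ?B (i, Suc j)" if "(i, Suc j) \<in> young_cells (m # xs)" for i j
    using attach_row_row_less[OF P S_sub cS that] .
  fix i j assume a: "(Suc i, j) \<in> young_cells (m # xs)"
  show "?B (i, j) < ?B (Suc i, j)"
  proof (cases i)
    case 0
    then show ?thesis using a attach_row_col_less_first_row[OF srt P S] by simp
  next
    case (Suc i')
    then have a': "(Suc i', j) \<in> young_cells xs" using a by simp
    have P_range: "P c \<in> {1..card S}" if "c \<in> young_cells xs" for c
      using SYT_range[OF P that] cS by simp
    have "0 < set_select S (P (Suc i', j))"
      using set_select_in[OF finS P_range[OF a']] S_sub by force
    then show ?thesis
      using Suc a' SYT_col_less[OF P a'] P_range set_select_strict_mono[OF finS]
      by (cases "(i', j) \<in> young_cells xs") (simp_all add: attach_row_def)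
  qed
qed

section \<open>Counting tableaux by their first row\<close>

lemma card_SYT_Cons_le:
  assumes "sorted_wrt (\<ge>) (m # xs)"
  shows "card (SYT (m # xs)) \<le> card (SYT xs) * ((m + sum_list xs - 1) choose sum_list xs)"
proof -
  let ?split = "\<lambda>T. (lower_tableau xs T, lower_entries xs T)"
  let ?Sub = "{S. S \<subseteq> {2..m + sum_list xs} \<and> card S = sum_list xs}"
  have "inj_on ?split (SYT (m # xs))"
    by (rule inj_on_inverseI[where g = "\<lambda>(P, S). attach_row m xs P S"])
      (simp add: attach_row_lower_parts)
  moreover have "?split ` SYT (m # xs) \<subseteq> SYT xs \<times> ?Sub"
    using lower_tableau_SYT[OF assms] lower_entries_subset[OF assms] card_lower_entries by auto
  moreover have "finite (SYT xs \<times> ?Sub)" using finite_SYT by auto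
  ultimately have "card (SYT (m # xs)) \<le> card (SYT xs \<times> ?Sub)"
    by (rule card_inj_on_le)
  also have "\<dots> = card (SYT xs) * card ?Sub" by (rule card_cartesian_product)
  also have "card ?Sub = card {2..m + sum_list xs} choose sum_list xs"
    by (rule n_subsets) simp
  finally show ?thesis by simp
qed

lemma card_SYT_Cons_ge:
  assumes "sorted_wrt (\<ge>) (m # xs)"
  shows "card (SYT xs) * card {S. row_attachable m xs S} \<le> card (SYT (m # xs))"
proof -
  let ?G = "{S. row_attachable m xs S}"
  have "inj_on (\<lambda>(P, S). attach_row m xs P S) (SYT xs \<times> ?G)"
    by (rule inj_on_inverseI[where g = "\<lambda>T. (lower_tableau xs T, lower_entries xs T)"])
      (auto simp: lower_parts_attach_row row_attachable_def)
  moreover have "(\<lambda>(P, S). attach_row m xs P S) ` (SYT xs \<times> ?G) \<subseteq> SYT (m # xs)"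
    using attach_row_SYT[OF assms] by auto
  ultimately have "card (SYT xs \<times> ?G) \<le> card (SYT (m # xs))"
    using finite_SYT by (intro card_inj_on_le) auto
  then show ?thesis by (simp add: card_cartesian_product)
qed

lemma row_attachable_top:
  assumes "1 \<le> m"
  shows "row_attachable m xs {m + 1..m + sum_list xs}"
proof -
  have "{y \<in> {1..m + sum_list xs} - {m + 1..m + sum_list xs}. y < x} = {1..m}"
    if "x \<in> {m + 1..m + sum_list xs}" for x
    using that by auto
  then show ?thesis unfolding row_attachable_def using assms by auto
qed

definition crowded_subsets :: "nat \<Rightarrow> nat \<Rightarrow> nat set set" where
  "crowded_subsets n s = {S. S \<subseteq> {2..n} \<and> card S = s \<and> 2 \<le> card (S \<inter> {2..2 * s})}"

text \<open>An element of rank at least 2 in a non-crowded \<open>S\<close> exceeds \<open>2 s\<close>, so at least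
  \<open>2 s - 1 \<ge> s\<close> elements of the complement lie below it.\<close>

lemma row_attachable_if_not_crowded:
  assumes S: "S \<subseteq> {2..m + sum_list xs}" "card S = sum_list xs"
    and sparse: "S \<notin> crowded_subsets (m + sum_list xs) (sum_list xs)"
  shows "row_attachable m xs S"
proof -
  let ?n = "m + sum_list xs" and ?s = "sum_list xs"
  let ?R = "{1..?n} - S" and ?W = "S \<inter> {2..2 * ?s}"
  have finS: "finite S" by (rule finite_subset[OF S(1)]) simp
  have W: "card ?W \<le> 1" using sparse S unfolding crowded_subsets_def by auto
  have "min (set_rank S x) m \<le> card {y \<in> ?R. y < x}" if x: "x \<in> S" for x
  proof (cases "set_rank S x \<le> 1")
    case True
    have "1 \<in> {y \<in> ?R. y < x}" using x S(1) by auto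
    moreover have "finite {y \<in> ?R. y < x}" by simp
    ultimately have "1 \<le> card {y \<in> ?R. y < x}"
      by (metis One_nat_def Suc_leI card_gt_0_iff empty_iff)
    then show ?thesis using True by simp
  next
    case False
    have "2 * ?s < x"
    proof (rule ccontr)
      assume "\<not> 2 * ?s < x"
      then have "{y \<in> S. y \<le> x} \<subseteq> ?W" using S(1) by auto
      then have "set_rank S x \<le> card ?W" unfolding set_rank_def by (intro card_mono) auto
      then show False using False W by simp
    qed
    moreover have "x \<le> ?n" using x S(1) by auto
    ultimately have "{1..2 * ?s} - ?W \<subseteq> {y \<in> ?R. y < x}" using S(1) by auto
    then have "card ({1..2 * ?s} - ?W) \<le> card {y \<in> ?R. y < x}" by (intro card_mono) auto
    moreover have "2 * ?s - card ?W \<le> card ({1..2 * ?s} - ?W)"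
      using diff_card_le_card_Diff[of ?W "{1..2 * ?s}"] by simp
    moreover have "set_rank S x \<le> ?s" using set_rank_le_card[OF finS, of x] S(2) by simp
    ultimately show ?thesis using W by simp
  qed
  then show ?thesis unfolding row_attachable_def using S by auto
qed

lemma binomial_le_power: "n choose k \<le> n ^ k"
proof -
  have "n choose k \<le> (n choose k) * fact k" by simp
  also have "\<dots> \<le> n ^ k" by (rule binomial_fact_pow)
  finally show ?thesis .
qed

lemma card_subsets_containing_pair:
  assumes "a \<noteq> b"
  shows "card {S. S \<subseteq> {1..n} \<and> card S = s \<and> a \<in> S \<and> b \<in> S} \<le> n ^ (s - 2)"
proof -
  let ?F = "{S. S \<subseteq> {1..n} \<and> card S = s \<and> a \<in> S \<and> b \<in> S}"
  let ?T = "{T. T \<subseteq> {1..n} \<and> card T = s - 2}"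
  have "inj_on (\<lambda>S. S - {a, b}) ?F" by (rule inj_onI) auto
  moreover have "(\<lambda>S. S - {a, b}) ` ?F \<subseteq> ?T"
  proof
    fix T assume "T \<in> (\<lambda>S. S - {a, b}) ` ?F"
    then obtain S where S: "S \<in> ?F" "T = S - {a, b}" by auto
    moreover have "finite S" using S(1) by (auto intro: finite_subset)
    ultimately show "T \<in> ?T" using assms by (auto simp: card_Diff_subset)
  qed
  ultimately have "card ?F \<le> card ?T" by (rule card_inj_on_le) simp
  also have "card ?T = n choose (s - 2)" using n_subsets[of "{1..n}" "s - 2"] by simp
  also have "\<dots> \<le> n ^ (s - 2)" by (rule binomial_le_power)
  finally show ?thesis .
qed

lemma card_crowded_subsets: "card (crowded_subsets n s) * n ^ 2 \<le> (2 * s) ^ 2 * n ^ s"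
proof (cases "s \<le> 1")
  case True
  have "card (S \<inter> {2..2 * s}) \<le> card {2..2 * s}" for S by (intro card_mono) auto
  moreover have "card {2..2 * s} < 2" using True by (cases s) auto
  ultimately have "card (S \<inter> {2..2 * s}) < 2" for S by (rule le_less_trans)
  then have "crowded_subsets n s = {}" unfolding crowded_subsets_def using leD by blast
  then show ?thesis by simp
next
  case False
  let ?W = "{2..2 * s}"
  let ?I = "{(a, b). a \<in> ?W \<and> b \<in> ?W \<and> a \<noteq> b}"
  let ?F = "\<lambda>(a::nat, b::nat). {S. S \<subseteq> {1..n} \<and> card S = s \<and> a \<in> S \<and> b \<in> S}"
  have finI: "finite ?I" by (rule finite_subset[of _ "?W \<times> ?W"]) auto
  have cover: "crowded_subsets n s \<subseteq> (\<Union>p\<in>?I. ?F p)"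
  proof
    fix S assume S: "S \<in> crowded_subsets n s"
    then have "\<not> card (S \<inter> ?W) \<le> Suc 0" unfolding crowded_subsets_def by simp
    then obtain a b where "a \<in> S \<inter> ?W" "b \<in> S \<inter> ?W" "a \<noteq> b"
      using card_le_Suc0_iff_eq[of "S \<inter> ?W"] by blast
    then have "(a, b) \<in> ?I" "S \<in> ?F (a, b)" using S unfolding crowded_subsets_def by auto
    then show "S \<in> (\<Union>p\<in>?I. ?F p)" by blast
  qed
  have "card ?I \<le> card (?W \<times> ?W)" by (intro card_mono) auto
  also have "\<dots> = (2 * s - 1) ^ 2" by (simp add: card_cartesian_product power2_eq_square)
  also have "\<dots> \<le> (2 * s) ^ 2" by (intro power_mono) auto
  finally have card_I: "card ?I \<le> (2 * s) ^ 2" .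
  have "(\<Union>p\<in>?I. ?F p) \<subseteq> Pow {1..n}" by auto
  then have "card (crowded_subsets n s) \<le> card (\<Union>p\<in>?I. ?F p)"
    by (intro card_mono[OF _ cover]) (auto intro: finite_subset)
  also have "\<dots> \<le> (\<Sum>p\<in>?I. card (?F p))" by (rule card_UN_le[OF finI])
  also have "\<dots> \<le> card ?I * n ^ (s - 2)"
    using sum_mono[of ?I _ "\<lambda>_. n ^ (s - 2)"] card_subsets_containing_pair by fastforce
  also have "\<dots> \<le> (2 * s) ^ 2 * n ^ (s - 2)" using card_I by (rule mult_le_mono1)
  finally have "card (crowded_subsets n s) * n ^ 2 \<le> (2 * s) ^ 2 * (n ^ (s - 2) * n ^ 2)" by simp
  also have "n ^ (s - 2) * n ^ 2 = n ^ s"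
    using False by (metis le_add_diff_inverse2 not_le power_add Suc_1 Suc_leI)
  finally show ?thesis .
qed

lemma dim_irrep_Cons_le:
  assumes "sorted_wrt (\<ge>) (m # xs)"
  shows "dim_irrep (m # xs) \<le> dim_irrep xs * ((m + sum_list xs - 1) choose sum_list xs)"
  unfolding dim_irrep_def by (rule card_SYT_Cons_le[OF assms])

lemma finite_row_attachable: "finite {S. row_attachable m xs S}"
  by (rule finite_subset[of _ "Pow {1..m + sum_list xs}"]) (auto simp: row_attachable_def)

lemma dim_irrep_le_Cons:
  assumes "sorted_wrt (\<ge>) (m # xs)" "1 \<le> m"
  shows "dim_irrep xs \<le> dim_irrep (m # xs)"
proof -
  have "{S. row_attachable m xs S} \<noteq> {}" using row_attachable_top[OF assms(2)] by blast
  then have "1 \<le> card {S. row_attachable m xs S}"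
    using finite_row_attachable by (simp add: Suc_le_eq card_gt_0_iff)
  then have "dim_irrep xs \<le> dim_irrep xs * card {S. row_attachable m xs S}" by simp
  also have "\<dots> \<le> dim_irrep (m # xs)" unfolding dim_irrep_def by (rule card_SYT_Cons_ge[OF assms(1)])
  finally show ?thesis .
qed

lemma card_crowded_subsets_le_binomial: "card (crowded_subsets n s) \<le> (n - 1) choose s"
proof -
  have "crowded_subsets n s \<subseteq> {S. S \<subseteq> {2..n} \<and> card S = s}"
    unfolding crowded_subsets_def by auto
  then have "card (crowded_subsets n s) \<le> card {S. S \<subseteq> {2..n} \<and> card S = s}"
    by (intro card_mono) (auto intro: finite_subset[of _ "Pow {2..n}"])
  also have "\<dots> = (n - 1) choose s" using n_subsets[of "{2..n}" s] by simp
  finally show ?thesis .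
qed

lemma dim_irrep_Cons_ge:
  assumes "sorted_wrt (\<ge>) (m # xs)"
  defines "n \<equiv> m + sum_list xs" and "s \<equiv> sum_list xs"
  shows "dim_irrep xs * (((n - 1) choose s) - card (crowded_subsets n s)) \<le> dim_irrep (m # xs)"
proof -
  let ?Sub = "{S. S \<subseteq> {2..n} \<and> card S = s}"
  have "?Sub - crowded_subsets n s \<subseteq> {S. row_attachable m xs S}"
    using row_attachable_if_not_crowded unfolding n_def s_def by blast
  then have "card (?Sub - crowded_subsets n s) \<le> card {S. row_attachable m xs S}"
    by (rule card_mono[OF finite_row_attachable])
  moreover have "card ?Sub - card (crowded_subsets n s) \<le> card (?Sub - crowded_subsets n s)"
    by (rule diff_card_le_card_Diff)
      (auto simp: crowded_subsets_def intro: finite_subset[of _ "Pow {2..n}"])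
  moreover have "card ?Sub = (n - 1) choose s" using n_subsets[of "{2..n}" s] by simp
  ultimately have "((n - 1) choose s) - card (crowded_subsets n s) \<le> card {S. row_attachable m xs S}"
    by simp
  then have "dim_irrep xs * (((n - 1) choose s) - card (crowded_subsets n s))
      \<le> dim_irrep xs * card {S. row_attachable m xs S}" by (rule mult_le_mono2)
  also have "\<dots> \<le> dim_irrep (m # xs)" unfolding dim_irrep_def by (rule card_SYT_Cons_ge[OF assms(1)])
  finally show ?thesis .
qed

lemma dim_irrep_Nil [simp]: "dim_irrep [] = 1"
  unfolding dim_irrep_def SYT_Nil by simp

lemma dim_irrep_pos:
  assumes "sorted_wrt (\<ge>) xs" "\<forall>x\<in>set xs. 0 < x"
  shows "1 \<le> dim_irrep xs"
  using assms
proof (induction xs)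
  case (Cons m xs)
  then have "1 \<le> dim_irrep xs" by simp
  also have "\<dots> \<le> dim_irrep (m # xs)" using Cons.prems by (intro dim_irrep_le_Cons) auto
  finally show ?case .
qed simp

lemma dim_irrep_le_self_power: "dim_irrep xs \<le> sum_list xs ^ sum_list xs"
  unfolding dim_irrep_def by (rule card_SYT_le)

lemma tl_partition: "is_partition n lam \<Longrightarrow> is_partition (n - first_row lam) (tl lam)"
  unfolding is_partition_def first_row_def by (cases lam) auto

lemma partition_Cons:
  assumes "is_partition n (m # xs)"
  shows "sorted_wrt (\<ge>) (m # xs)" "1 \<le> m" "n = m + sum_list xs"
  using assms unfolding is_partition_def by auto

lemma dim_irrep_partition_pos: "is_partition n lam \<Longrightarrow> 1 \<le> dim_irrep lam"
  unfolding is_partition_def by (blast intro: dim_irrep_pos)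

lemma young_cells_tl: "(i, j) \<in> young_cells (tl xs) \<longleftrightarrow> (Suc i, j) \<in> young_cells xs"
  by (cases xs) auto

lemma tl_eq_if_contained:
  assumes lam: "is_partition n lam" and mu: "is_partition f mu" and "contained mu lam"
    and "f - first_row mu = n - first_row lam"
  shows "tl mu = tl lam"
proof -
  have "young_cells (tl mu) \<subseteq> young_cells (tl lam)"
    using \<open>contained mu lam\<close> unfolding contained_def by (auto simp: young_cells_tl)
  moreover have "card (young_cells (tl mu)) = card (young_cells (tl lam))"
    using tl_partition[OF lam] tl_partition[OF mu] assms(4)
    by (simp add: card_young_cells is_partition_def)
  ultimately have "young_cells (tl mu) = young_cells (tl lam)" by (intro card_subset_eq) auto
  then show ?thesis
    using tl_partition[OF lam] tl_partition[OF mu] young_cells_inject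
    unfolding is_partition_def by blast
qed

section \<open>Expansion of the dimension\<close>

text \<open>\<open>tri_num\<close> is the paper's \<open>T\<close>; in \<open>dim_err\<close> the first summand bounds the second-order term of
  the binomial expansion, the second the crowded subsets.\<close>

definition tri_num :: "nat \<Rightarrow> real" where
  "tri_num s = real (s * (s + 1)) / 2"

definition dim_err :: "nat \<Rightarrow> real" where
  "dim_err s = tri_num s ^ 2 + 4 * real s ^ 2 * fact s"

lemma tri_num_nonneg: "0 \<le> tri_num s"
  unfolding tri_num_def by simp

lemma tri_num_mono: "s \<le> r \<Longrightarrow> tri_num s \<le> tri_num r"
  unfolding tri_num_def by (intro divide_right_mono of_nat_mono mult_le_mono) auto

lemma dim_err_nonneg: "0 \<le> dim_err s"
  unfolding dim_err_def by simp

lemma dim_err_mono: "s \<le> r \<Longrightarrow> dim_err s \<le> dim_err r"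
  unfolding dim_err_def using tri_num_mono[of s r] tri_num_nonneg[of s]
  by (intro add_mono power_mono mult_mono fact_mono) auto

lemma prod_one_minus_bounds:
  fixes x :: "'a \<Rightarrow> real"
  assumes "finite I" "\<And>i. i \<in> I \<Longrightarrow> 0 \<le> x i \<and> x i \<le> 1"
  shows "1 - sum x I \<le> (\<Prod>i\<in>I. 1 - x i)"
    and "(\<Prod>i\<in>I. 1 - x i) \<le> 1 - sum x I + (sum x I)\<^sup>2 / 2"
proof -
  have "1 - sum x I \<le> (\<Prod>i\<in>I. 1 - x i) \<and> (\<Prod>i\<in>I. 1 - x i) \<le> 1 - sum x I + (sum x I)\<^sup>2 / 2"
    using assms
  proof (induction I rule: finite_induct)
    case (insert j F)
    let ?P = "\<Prod>i\<in>F. 1 - x i" and ?S = "sum x F" and ?y = "x j"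
    have IH: "1 - ?S \<le> ?P" "?P \<le> 1 - ?S + ?S\<^sup>2 / 2" using insert by auto
    have y: "0 \<le> ?y" "?y \<le> 1" using insert by auto
    have S: "0 \<le> ?S" using insert by (intro sum_nonneg) auto
    have "(1 - ?y) * (1 - ?S) \<le> (1 - ?y) * ?P" "(1 - ?y) * ?P \<le> (1 - ?y) * (1 - ?S + ?S\<^sup>2 / 2)"
      using IH y by (auto intro: mult_left_mono)
    moreover have "1 - (?y + ?S) \<le> (1 - ?y) * (1 - ?S)" using y S by (simp add: algebra_simps)
    moreover have "(1 - ?y) * (1 - ?S + ?S\<^sup>2 / 2) \<le> 1 - (?y + ?S) + (?y + ?S)\<^sup>2 / 2"
    proof -
      have "0 \<le> ?y\<^sup>2 / 2 + ?y * ?S\<^sup>2 / 2" using y S by simp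
      then show ?thesis by (simp add: algebra_simps power2_eq_square)
    qed
    ultimately show ?case using insert by simp
  qed simp
  then show "1 - sum x I \<le> (\<Prod>i\<in>I. 1 - x i)"
    and "(\<Prod>i\<in>I. 1 - x i) \<le> 1 - sum x I + (sum x I)\<^sup>2 / 2" by auto
qed

lemma binomial_pred_ratio_eq_prod:
  assumes "1 \<le> p"
  shows "real ((p - 1) choose s) * fact s / real p ^ s = (\<Prod>i<s. 1 - (real i + 1) / real p)"
proof -
  have "real ((p - 1) choose s) * fact s = (\<Prod>i<s. real p - 1 - real i)"
    using assms by (simp add: binomial_gbinomial gbinomial_mult_fact' atLeast0LessThan)
  also have "\<dots> = (\<Prod>i<s. real p - (real i + 1))" by (simp add: algebra_simps)
  finally have "real ((p - 1) choose s) * fact s / real p ^ s = (\<Prod>i<s. (real p - (real i + 1)) / real p)"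
    by (simp add: prod_dividef)
  also have "\<dots> = (\<Prod>i<s. 1 - (real i + 1) / real p)"
    using assms by (intro prod.cong) (auto simp: field_simps)
  finally show ?thesis .
qed

lemma binomial_pred_ratio_bounds:
  assumes "1 \<le> p" "s \<le> p"
  defines "a \<equiv> real ((p - 1) choose s) * fact s / real p ^ s"
  shows "1 - tri_num s / real p \<le> a"
    and "a \<le> 1 - tri_num s / real p + tri_num s ^ 2 / real p ^ 2"
proof -
  let ?x = "\<lambda>i. (real i + 1) / real p"
  have x: "0 \<le> ?x i \<and> ?x i \<le> 1" if "i \<in> {..<s}" for i
    using assms that by (auto simp: field_simps)
  have "(\<Sum>i<s. real i + 1) = tri_num s"
    unfolding tri_num_def by (induction s) (simp_all add: field_simps)
  then have "(\<Sum>i<s. ?x i) = tri_num s / real p" by (simp add: sum_divide_distrib[symmetric])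
  moreover have "a = (\<Prod>i<s. 1 - ?x i)"
    unfolding a_def by (rule binomial_pred_ratio_eq_prod[OF assms(1)])
  ultimately have "1 - tri_num s / real p \<le> a" "a \<le> 1 - tri_num s / real p + (tri_num s / real p)\<^sup>2 / 2"
    using prod_one_minus_bounds[of "{..<s}" ?x] x by auto
  moreover have "(tri_num s / real p)\<^sup>2 / 2 \<le> tri_num s ^ 2 / real p ^ 2"
    by (simp add: power_divide divide_le_eq)
  ultimately show "1 - tri_num s / real p \<le> a"
    and "a \<le> 1 - tri_num s / real p + tri_num s ^ 2 / real p ^ 2" by linarith+
qed

lemma crowded_fraction_le:
  assumes "1 \<le> p"
  shows "real (card (crowded_subsets p s)) / (real p ^ s / fact s) \<le> 4 * real s ^ 2 * fact s / real p ^ 2"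
proof -
  have "real (card (crowded_subsets p s) * p ^ 2) \<le> real ((2 * s) ^ 2 * p ^ s)"
    using card_crowded_subsets[of p s] by (simp only: of_nat_le_iff)
  then have "real (card (crowded_subsets p s)) * real p ^ 2 \<le> 4 * real s ^ 2 * real p ^ s"
    by (simp add: power_mult_distrib)
  then show ?thesis using assms by (simp add: field_simps)
qed

lemma dim_irrep_Cons_expansion:
  assumes lam: "is_partition p (m # xs)"
  defines "s \<equiv> sum_list xs"
  obtains \<alpha> where "real (dim_irrep (m # xs))
      = real (dim_irrep xs) * (real p ^ s / fact s) * (1 - tri_num s / real p + \<alpha>)"
    and "\<bar>\<alpha>\<bar> \<le> dim_err s / real p ^ 2"
proof -
  note part = partition_Cons[OF lam]
  let ?D = "real (dim_irrep (m # xs))" and ?d = "real (dim_irrep xs)"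
  define K where "K = real p ^ s / fact s"
  define a where "a = real ((p - 1) choose s) * fact s / real p ^ s"
  define e where "e = real (card (crowded_subsets p s))"
  have p: "1 \<le> p" "s \<le> p" using part unfolding s_def by auto
  have d: "0 < ?d" using dim_irrep_partition_pos[OF tl_partition[OF lam]] by simp
  have K: "0 < K" unfolding K_def using p by simp
  have choose: "real ((p - 1) choose s) = K * a" unfolding K_def a_def using p by simp
  have "?D \<le> ?d * (K * a)"
    using dim_irrep_Cons_le[OF part(1)] part(3) unfolding s_def choose[symmetric]
    by (simp flip: of_nat_mult)
  then have upper: "?D / (?d * K) \<le> a"
    using d K by (simp add: pos_divide_le_eq mult.commute mult.left_commute)
  have "?d * (K * a - e) \<le> ?D"
    using dim_irrep_Cons_ge[OF part(1)] card_crowded_subsets_le_binomial[of p s] part(3)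
    unfolding s_def e_def choose[symmetric] by (simp flip: of_nat_mult of_nat_diff)
  moreover have "a - e / K = ?d * (K * a - e) / (?d * K)" using d K by (simp add: field_simps)
  ultimately have lower: "a - e / K \<le> ?D / (?d * K)"
    using d K by (metis divide_right_mono less_eq_real_def mult_pos_pos)
  have crowded: "e / K \<le> 4 * real s ^ 2 * fact s / real p ^ 2"
    using crowded_fraction_le[OF p(1)] unfolding e_def K_def .
  have "1 - tri_num s / real p \<le> a" "a \<le> 1 - tri_num s / real p + tri_num s ^ 2 / real p ^ 2"
    using binomial_pred_ratio_bounds[OF p] unfolding a_def by auto
  moreover have "0 \<le> tri_num s ^ 2 / real p ^ 2" "0 \<le> 4 * real s ^ 2 * fact s / real p ^ 2"
    by simp_all
  ultimately have "\<bar>?D / (?d * K) - (1 - tri_num s / real p)\<bar> \<le> dim_err s / real p ^ 2"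
    using upper lower crowded unfolding dim_err_def add_divide_distrib abs_le_iff by linarith
  moreover have "?D = ?d * K * (1 - tri_num s / real p + (?D / (?d * K) - (1 - tri_num s / real p)))"
    using d K by simp
  ultimately show thesis unfolding K_def by (intro that) auto
qed

text \<open>For \<open>lam = []\<close> this holds with \<open>n = 0\<close> by the conventions \<open>0 ^ 0 = 1\<close> and \<open>x / 0 = 0\<close>.\<close>

lemma dim_irrep_expansion:
  assumes lam: "is_partition n lam"
  defines "s \<equiv> n - first_row lam"
  obtains \<alpha> where "real (dim_irrep lam)
      = real (dim_irrep (tl lam)) * (real n ^ s / fact s) * (1 - tri_num s / real n + \<alpha>)"
    and "\<bar>\<alpha>\<bar> \<le> dim_err s / real n ^ 2"
proof (cases lam)
  case Nil
  then have "n = 0" "s = 0" using lam unfolding s_def is_partition_def first_row_def by auto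
  then show thesis using Nil by (intro that[of 0]) (simp_all add: tri_num_def)
next
  case (Cons m xs)
  then have "s = sum_list xs"
    using partition_Cons[OF lam[unfolded Cons]] unfolding s_def first_row_def by simp
  then show thesis using dim_irrep_Cons_expansion[OF lam[unfolded Cons]] that Cons by auto
qed

section \<open>Dimension ratios\<close>

definition expansion_threshold :: "nat \<Rightarrow> nat" where
  "expansion_threshold r = nat \<lceil>4 * (tri_num r + dim_err r)\<rceil> + 1"

lemma expansion_factor_ge_half:
  assumes "expansion_threshold r \<le> p" "s \<le> r" "\<bar>\<alpha>\<bar> \<le> dim_err s / real p ^ 2"
  shows "1 / 2 \<le> 1 - tri_num s / real p + \<alpha>"
proof -
  have "real (nat \<lceil>4 * (tri_num r + dim_err r)\<rceil> + 1) \<le> real p"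
    using assms(1) unfolding expansion_threshold_def by (simp only: of_nat_le_iff)
  then have p: "1 \<le> real p" "4 * (tri_num r + dim_err r) \<le> real p"
    using real_nat_ceiling_ge[of "4 * (tri_num r + dim_err r)"] by auto
  have "tri_num s / real p \<le> tri_num r / real p"
    using tri_num_mono[OF assms(2)] p(1) by (simp add: divide_right_mono)
  moreover have "dim_err s / real p ^ 2 \<le> dim_err r / real p"
  proof -
    have "dim_err s / real p ^ 2 \<le> dim_err r / real p ^ 2"
      using dim_err_mono[OF assms(2)] p(1) by (simp add: divide_right_mono)
    also have "\<dots> \<le> dim_err r / real p"
      using dim_err_nonneg[of r] p(1)
      by (intro divide_left_mono) (auto simp: power2_eq_square intro: order_trans[of _ "real p"])
    finally show ?thesis .
  qed
  moreover have "tri_num r / real p + dim_err r / real p \<le> 1 / 4"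
    using p by (simp add: add_divide_distrib[symmetric] divide_le_eq)
  ultimately show ?thesis using assms(3) by linarith
qed

lemma self_power_mono:
  fixes s r :: nat
  assumes "s \<le> r"
  shows "s ^ s \<le> r ^ r"
proof (cases "s = 0")
  case True then show ?thesis by (cases "r = 0") (auto simp: Suc_le_eq)
next
  case False
  then have "s ^ s \<le> r ^ s" using assms by (intro power_mono) auto
  also have "\<dots> \<le> r ^ r" using assms False by (intro power_increasing) auto
  finally show ?thesis .
qed

lemma one_le_self_power: "1 \<le> (of_nat (r ^ r) :: 'a::linordered_semidom)"
proof -
  have "1 \<le> r ^ r" using self_power_mono[of 0 r] by simp
  then show ?thesis by (metis of_nat_1 of_nat_le_iff)
qed

lemma dim_irrep_le_power:
  assumes lam: "is_partition n lam" and s: "n - first_row lam \<le> r"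
  shows "dim_irrep lam \<le> r ^ r * n ^ (n - first_row lam)"
proof (cases lam)
  case Nil
  then show ?thesis
    using lam one_le_self_power[of r, where 'a=nat] by (simp add: is_partition_def first_row_def)
next
  case (Cons m xs)
  note part = partition_Cons[OF lam[unfolded Cons]]
  let ?s = "sum_list xs"
  have s_eq: "n - first_row lam = ?s" using part(3) Cons by (simp add: first_row_def)
  have "?s ^ ?s \<le> r ^ r" using s s_eq by (intro self_power_mono) simp
  then have "dim_irrep xs \<le> r ^ r" using dim_irrep_le_self_power[of xs] by linarith
  moreover have "(n - 1) choose ?s \<le> n ^ ?s"
    using binomial_le_power[of "n - 1" ?s] power_mono[of "n - 1" n ?s] by simp
  ultimately have "dim_irrep xs * ((n - 1) choose ?s) \<le> r ^ r * n ^ ?s" by (rule mult_le_mono)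
  then show ?thesis using dim_irrep_Cons_le[OF part(1)] part(3) Cons s_eq by simp
qed

definition dim_lower :: "nat \<Rightarrow> real" where
  "dim_lower r = min (1 / (2 * fact r)) (1 / real (expansion_threshold r) ^ r)"

lemma dim_lower_pos: "0 < dim_lower r"
  unfolding dim_lower_def expansion_threshold_def by simp

lemma dim_lower_le_1: "dim_lower r \<le> 1"
proof -
  have "1 \<le> 2 * (fact r :: real)" using fact_ge_1[of r, where 'a=real] by linarith
  then show ?thesis unfolding dim_lower_def by (simp add: min_le_iff_disj)
qed

lemma dim_irrep_ge_power:
  assumes lam: "is_partition n lam" and s: "n - first_row lam \<le> r"
  shows "dim_lower r * real n ^ (n - first_row lam) \<le> real (dim_irrep lam)"
proof -
  define N where "N = expansion_threshold r"
  define s where "s = n - first_row lam"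
  have "1 \<le> N" unfolding N_def expansion_threshold_def by simp
  show ?thesis
  proof (cases "N \<le> n")
    case True
    obtain \<alpha> where \<alpha>: "real (dim_irrep lam)
        = real (dim_irrep (tl lam)) * (real n ^ s / fact s) * (1 - tri_num s / real n + \<alpha>)"
      "\<bar>\<alpha>\<bar> \<le> dim_err s / real n ^ 2"
      using dim_irrep_expansion[OF lam] unfolding s_def by blast
    have half: "1 / 2 \<le> 1 - tri_num s / real n + \<alpha>"
      using expansion_factor_ge_half[of r n s \<alpha>] True s \<alpha>(2) unfolding N_def s_def by auto
    have "1 \<le> real (dim_irrep (tl lam))"
      using dim_irrep_partition_pos[OF tl_partition[OF lam]] by simp
    have "dim_lower r \<le> 1 / (2 * fact r)" unfolding dim_lower_def by simp
    also have "\<dots> \<le> 1 / (2 * fact s)"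
      using fact_mono[OF s[folded s_def], where 'a=real] by (intro divide_left_mono) auto
    finally have "dim_lower r * real n ^ s \<le> 1 / (2 * fact s) * real n ^ s"
      by (rule mult_right_mono) simp
    also have "\<dots> = 1 * (real n ^ s / fact s) * (1 / 2)" by simp
    also have "\<dots> \<le> real (dim_irrep lam)"
      unfolding \<alpha>(1) using \<open>1 \<le> real (dim_irrep (tl lam))\<close> half by (intro mult_mono) auto
    finally show ?thesis unfolding s_def .
  next
    case False
    have "real n ^ s \<le> real N ^ r"
      using False \<open>1 \<le> N\<close> s unfolding s_def
      by (intro order_trans[OF power_mono power_increasing]) auto
    then have "dim_lower r * real n ^ s \<le> (1 / real N ^ r) * real N ^ r"
      unfolding dim_lower_def N_def by (intro mult_mono) auto
    also have "\<dots> \<le> real (dim_irrep lam)" using dim_irrep_partition_pos[OF lam] \<open>1 \<le> N\<close> by simp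
    finally show ?thesis unfolding s_def .
  qed
qed

lemma power_div_power_eq_powi:
  fixes x y :: real
  assumes "s + K = r" "x \<noteq> 0 \<or> K = 0"
  shows "x ^ s / y ^ r = (x / y) ^ r * x powi (- int K)"
  using assms by (auto simp: power_int_minus power_add field_simps)

lemma dim_irrep_ratio_bounds:
  assumes "0 < n" and lam: "is_partition n lam" "n - first_row lam = r"
    and mu: "is_partition f mu" "f - first_row mu = r - K" and "K \<le> r" "0 < f \<or> K = 0"
  defines "q \<equiv> real (dim_irrep mu) / real (dim_irrep lam)"
    and "X \<equiv> (real f / real n) ^ r * real f powi (- int K)"
  shows "dim_lower r / real (r ^ r) * X \<le> q" and "q \<le> real (r ^ r) / dim_lower r * X"
proof -
  let ?c = "dim_lower r" and ?R = "real (r ^ r)"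
  have dim_le: "real (dim_irrep lam) \<le> ?R * real n ^ (n - first_row lam)"
    if "is_partition n lam" "n - first_row lam \<le> r" for n lam
    using dim_irrep_le_power[OF that] by (simp flip: of_nat_power of_nat_mult)
  have R: "1 \<le> ?R" by (rule one_le_self_power)
  have X: "X = real f ^ (r - K) / real n ^ r"
    unfolding X_def using assms(6,7) by (intro power_div_power_eq_powi[symmetric]) auto
  have bounds: "?c * real f ^ (r - K) \<le> real (dim_irrep mu)" "real (dim_irrep mu) \<le> ?R * real f ^ (r - K)"
    "?c * real n ^ r \<le> real (dim_irrep lam)" "real (dim_irrep lam) \<le> ?R * real n ^ r"
    using dim_irrep_ge_power[OF mu(1)] dim_le[OF mu(1)] dim_irrep_ge_power[OF lam(1)] dim_le[OF lam(1)]
      lam(2) mu(2) by auto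
  have "0 < ?c * real n ^ r" using dim_lower_pos \<open>0 < n\<close> by simp
  then have "(?c * real f ^ (r - K)) / (?R * real n ^ r) \<le> q" "q \<le> (?R * real f ^ (r - K)) / (?c * real n ^ r)"
    unfolding q_def using bounds R by (auto intro!: frac_le)
  then show "?c / ?R * X \<le> q" "q \<le> ?R / ?c * X" unfolding X by simp_all
qed

lemma ratio_error_bound:
  fixes f n T A \<alpha> \<beta> :: real
  assumes f: "1 \<le> f" "f \<le> n" and \<alpha>: "\<bar>\<alpha>\<bar> \<le> A / f\<^sup>2" and \<beta>: "\<bar>\<beta>\<bar> \<le> A / n\<^sup>2"
    and half: "1 / 2 \<le> 1 - T / n + \<beta>" and "0 \<le> T" "0 \<le> A"
  shows "\<bar>(1 - T / f + \<alpha>) / (1 - T / n + \<beta>) - (1 - T * ((n - f) / (f * n)))\<bar>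
    \<le> 2 * (A + 2 * T\<^sup>2 + A * (1 + T)) / f\<^sup>2"
proof -
  define u where "u = 1 - T / f + \<alpha>"
  define v where "v = 1 - T / n + \<beta>"
  define w where "w = 1 - T / f + T / n"
  have pos: "0 < f" "0 < n" using f by auto
  have w_eq: "1 - T * ((n - f) / (f * n)) = w" unfolding w_def using pos by (simp add: field_simps)
  have key: "u - v * w = \<alpha> - T\<^sup>2 / (f * n) + T\<^sup>2 / n\<^sup>2 - \<beta> * w"
    unfolding u_def v_def w_def using pos by (simp add: field_simps power2_eq_square)
  have fn: "1 / (f * n) \<le> 1 / f\<^sup>2" "1 / n\<^sup>2 \<le> 1 / f\<^sup>2"
    using pos f by (auto simp: power2_eq_square intro!: divide_left_mono mult_mono)
  have "\<bar>w\<bar> \<le> 1 + T"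
  proof -
    have "T / f \<le> T" "T / n \<le> T" using f \<open>0 \<le> T\<close> by (auto simp: divide_le_eq mult_le_cancel_left1)
    moreover have "0 \<le> T / f" "0 \<le> T / n" using \<open>0 \<le> T\<close> pos by auto
    ultimately show ?thesis unfolding w_def by linarith
  qed
  moreover have "\<bar>\<beta>\<bar> \<le> A / f\<^sup>2"
    using \<beta> fn(2) \<open>0 \<le> A\<close> by (metis order_trans divide_inverse inverse_eq_divide mult_left_mono)
  ultimately have "\<bar>\<beta> * w\<bar> \<le> A / f\<^sup>2 * (1 + T)"
    unfolding abs_mult by (intro mult_mono) auto
  moreover have "T\<^sup>2 / (f * n) \<le> T\<^sup>2 / f\<^sup>2" "T\<^sup>2 / n\<^sup>2 \<le> T\<^sup>2 / f\<^sup>2"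
    "0 \<le> T\<^sup>2 / (f * n)" "0 \<le> T\<^sup>2 / n\<^sup>2"
    using fn pos by (auto simp: divide_inverse intro!: mult_left_mono)
  ultimately have "\<bar>u - v * w\<bar> \<le> A / f\<^sup>2 + 2 * (T\<^sup>2 / f\<^sup>2) + A / f\<^sup>2 * (1 + T)"
    unfolding key abs_le_iff using \<alpha> by linarith
  also have "\<dots> = (A + 2 * T\<^sup>2 + A * (1 + T)) / f\<^sup>2" using pos by (simp add: field_simps)
  finally have num: "\<bar>u - v * w\<bar> \<le> (A + 2 * T\<^sup>2 + A * (1 + T)) / f\<^sup>2" .
  have v: "1 / 2 \<le> v" using half unfolding v_def .
  then have "\<bar>u / v - w\<bar> = \<bar>u - v * w\<bar> / v" by (simp add: field_simps)
  also have "\<dots> \<le> 2 * \<bar>u - v * w\<bar>"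
    using v mult_left_mono[of 1 "2 * v" "\<bar>u - v * w\<bar>"] by (simp add: pos_divide_le_eq)
  also have "\<dots> \<le> 2 * ((A + 2 * T\<^sup>2 + A * (1 + T)) / f\<^sup>2)" using num by (rule mult_left_mono) simp
  also have "\<dots> = 2 * (A + 2 * T\<^sup>2 + A * (1 + T)) / f\<^sup>2" by (rule times_divide_eq_right)
  finally show ?thesis unfolding u_def v_def w_eq .
qed

definition ratio_err :: "nat \<Rightarrow> real" where
  "ratio_err r = 2 * (dim_err r + 2 * (tri_num r)\<^sup>2 + dim_err r * (1 + tri_num r))"

lemma dim_irrep_ratio_same_tail:
  assumes n: "expansion_threshold r \<le> n" and "f \<le> n"
    and lam: "is_partition n lam" and mu: "is_partition f mu"
    and tl: "tl mu = tl lam" and r: "n - first_row lam = r" and C: "ratio_err r \<le> C"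
  shows "\<exists>E. real (dim_irrep mu) / real (dim_irrep lam)
      = (real f / real n) ^ r * (1 - real (r * (r + 1)) / 2 * (real (n - f) / (real f * real n)) + E)
    \<and> \<bar>E\<bar> \<le> C / real f ^ 2"
proof -
  let ?T = "tri_num r" and ?A = "dim_err r"
  have r_mu: "f - first_row mu = r"
    using tl_partition[OF lam] tl_partition[OF mu] tl r by (simp add: is_partition_def)
  obtain \<beta> where \<beta>: "real (dim_irrep lam)
      = real (dim_irrep (tl lam)) * (real n ^ r / fact r) * (1 - ?T / real n + \<beta>)"
    "\<bar>\<beta>\<bar> \<le> ?A / real n ^ 2"
    using dim_irrep_expansion[OF lam] unfolding r by blast
  obtain \<alpha> where \<alpha>: "real (dim_irrep mu)
      = real (dim_irrep (tl lam)) * (real f ^ r / fact r) * (1 - ?T / real f + \<alpha>)"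
    "\<bar>\<alpha>\<bar> \<le> ?A / real f ^ 2"
    using dim_irrep_expansion[OF mu] unfolding r_mu tl by blast
  have half: "1 / 2 \<le> 1 - ?T / real n + \<beta>"
    using expansion_factor_ge_half[OF n order_refl \<beta>(2)] .
  have "0 < real (dim_irrep (tl lam))" using dim_irrep_partition_pos[OF tl_partition[OF lam]] by simp
  then have q: "real (dim_irrep mu) / real (dim_irrep lam)
      = (real f / real n) ^ r * ((1 - ?T / real f + \<alpha>) / (1 - ?T / real n + \<beta>))"
    unfolding \<alpha>(1) \<beta>(1) using half by (simp add: power_divide)
  define E where "E = (1 - ?T / real f + \<alpha>) / (1 - ?T / real n + \<beta>)
    - (1 - ?T * (real (n - f) / (real f * real n)))"
  have "\<bar>E\<bar> \<le> ratio_err r / real f ^ 2"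
  proof (cases "f = 0")
    case True
    then have "r = 0" using r_mu by simp
    then show ?thesis using \<alpha>(2) \<beta>(2) True unfolding E_def tri_num_def dim_err_def by simp
  next
    case False
    then show ?thesis
      using ratio_error_bound[OF _ _ \<alpha>(2) \<beta>(2) half tri_num_nonneg dim_err_nonneg] \<open>f \<le> n\<close>
      unfolding E_def ratio_err_def by simp
  qed
  also have "\<dots> \<le> C / real f ^ 2" using C by (simp add: divide_right_mono)
  finally have "\<bar>E\<bar> \<le> C / real f ^ 2" .
  moreover have "real (dim_irrep mu) / real (dim_irrep lam)
      = (real f / real n) ^ r * (1 - ?T * (real (n - f) / (real f * real n)) + E)"
    unfolding q E_def by simp
  ultimately show ?thesis unfolding tri_num_def by blast
qed

theorem lemma2p9:
  fixes r :: nat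
  shows "\<exists>c C :: real. \<exists>N :: nat. 0 < c \<and> c \<le> C \<and>
    (\<forall>n K f lam mu. n \<ge> N \<longrightarrow> K \<le> r \<longrightarrow> 2 * r \<le> f \<longrightarrow> f \<le> n \<longrightarrow>
       is_partition n lam \<longrightarrow> n - first_row lam = r \<longrightarrow>
       is_partition f mu \<longrightarrow> contained mu lam \<longrightarrow> f - first_row mu = r - K \<longrightarrow>
       (let q = real (dim_irrep mu) / real (dim_irrep lam) in
          c * (real f / real n) ^ r * real f powi (- int K) \<le> q \<and>
          q \<le> C * (real f / real n) ^ r * real f powi (- int K) \<and>
          (K = 0 \<longrightarrow> (\<exists>E :: real.
              q = (real f / real n) ^ r *
                  (1 - real (r * (r + 1)) / 2 * (real (n - f) / (real f * real n)) + E)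
              \<and> \<bar>E\<bar> \<le> C / real f ^ 2))))"
proof -
  define c where "c = dim_lower r / real (r ^ r)"
  define C where "C = max (real (r ^ r) / dim_lower r) (ratio_err r)"
  have R: "1 \<le> real (r ^ r)" by (rule one_le_self_power)
  have c: "0 < c" "c \<le> C"
    unfolding c_def C_def using dim_lower_pos[of r] dim_lower_le_1[of r] R
    by (auto intro!: divide_pos_pos max.coboundedI1 frac_le)
  show ?thesis
  proof (unfold Let_def, rule exI[of _ c], rule exI[of _ C], rule exI[of _ "expansion_threshold r"],
      intro conjI allI impI)
    show "0 < c" "c \<le> C" by (fact c)+
    fix n K f lam mu
    assume n: "expansion_threshold r \<le> n" and "K \<le> r" "2 * r \<le> f" "f \<le> n"
      and lam: "is_partition n lam" and r: "n - first_row lam = r"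
      and mu: "is_partition f mu" and "contained mu lam" and r_mu: "f - first_row mu = r - K"
    have "0 < n" using n unfolding expansion_threshold_def by linarith
    have "0 < f \<or> K = 0" using \<open>K \<le> r\<close> \<open>2 * r \<le> f\<close> by auto
    note ratio = dim_irrep_ratio_bounds[OF \<open>0 < n\<close> lam r mu r_mu \<open>K \<le> r\<close> this]
    let ?q = "real (dim_irrep mu) / real (dim_irrep lam)"
    let ?X = "(real f / real n) ^ r * real f powi (- int K)"
    show "c * (real f / real n) ^ r * real f powi (- int K) \<le> ?q"
      using ratio(1) unfolding c_def by (simp add: mult.assoc)
    have "real (r ^ r) / dim_lower r * ?X \<le> C * ?X" unfolding C_def by (intro mult_right_mono) auto
    with ratio(2) show "?q \<le> C * (real f / real n) ^ r * real f powi (- int K)"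
      unfolding mult.assoc by (rule order_trans)
    assume "K = 0"
    then have "tl mu = tl lam" using tl_eq_if_contained[OF lam mu \<open>contained mu lam\<close>] r r_mu by simp
    then show "\<exists>E. ?q = (real f / real n) ^ r *
        (1 - real (r * (r + 1)) / 2 * (real (n - f) / (real f * real n)) + E) \<and> \<bar>E\<bar> \<le> C / real f ^ 2"
      using dim_irrep_ratio_same_tail[OF n \<open>f \<le> n\<close> lam mu _ r] unfolding C_def by simp
  qed
qed

end
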